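(* Let $P,Q\in\mathbb{Z}[x]$ be monic polynomials. Then for every positive integer $n$, $$\sum_{m\mid n}\mu\Big(\frac nm\Big)\operatorname{Res}(P_m,Q)\equiv0\pmod n,$$ where $\mu$ is the Möbius function.
   Context: If $P$ has degree $d$ and roots $\alpha_1,\dots,\alpha_d$ (with multiplicity), $P_m(x):=\prod_{j=1}^d(x-\alpha_j^m)\in\mathbb{Z}[x]$. For monic $A,B$, $\operatorname{Res}(A,B)=\prod_{A(a)=0,B(b)=0}(a-b)$. *)

theory Defs
  imports
    Complex_Main
    "HOL-Computational_Algebra.Computational_Algebra"
    "HOL-Number_Theory.Cong"
begin

definition moebius_mu :: "nat \<Rightarrow> int" where
  "moebius_mu n = (if squarefree n then (-1) ^ card (prime_factors n) else 0)"

text \<open>The roots of an integer polynomial are its complex roots, with multiplicity.\<close>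

abbreviation complex_poly :: "int poly \<Rightarrow> complex poly" where
  "complex_poly \<equiv> map_poly of_int"

text \<open>For monic \<open>P\<close> with roots \<open>\<alpha>\<^sub>1, \<dots>, \<alpha>\<^sub>d\<close> this is the monic polynomial with roots
  \<open>\<alpha>\<^sub>1 ^ m, \<dots>, \<alpha>\<^sub>d ^ m\<close>. Its coefficients are integers; it is represented over the complex numbers,
  where its defining product lives.\<close>

definition root_power_poly :: "int poly \<Rightarrow> nat \<Rightarrow> complex poly" where
  "root_power_poly P m = (\<Prod>\<alpha>\<in>#proots (complex_poly P). [:- (\<alpha> ^ m), 1:])"

text \<open>This is the resultant only for monic arguments: there are no leading coefficient factors.\<close>

definition monic_resultant :: "complex poly \<Rightarrow> complex poly \<Rightarrow> complex" where
  "monic_resultant A B = (\<Prod>a\<in>#proots A. \<Prod>b\<in>#proots B. a - b)"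

end

theory Submission
  imports Defs "Jordan_Normal_Form.Char_Poly"
begin

text \<open>
  For monic \<open>P\<close> of degree \<open>d\<close> let \<open>N\<^sub>P(G)\<close> be the determinant of multiplication by \<open>G\<close> on \<open>K[x]/(P)\<close>.
  It is multiplicative in \<open>G\<close>, compatible with ring homomorphisms, and equals the product of the
  values of \<open>G\<close> at the roots of \<open>P\<close>. Hence \<open>P\<^sub>k = N\<^sub>P(y - x\<^sup>k)\<close> makes sense over any domain, and
  \<open>Res(P\<^sub>m, Q)\<close> is up to a fixed sign \<open>N\<^sub>Q(P\<^sub>m)\<close>, so congruences between the coefficients of the
  \<open>P\<^sub>m\<close> carry over to the resultants.

  Let \<open>p\<close> be prime. Since \<open>(y - x)\<^sup>p\<close> and \<open>y\<^sup>p - x\<^sup>p\<close> agree modulo \<open>p\<close>, taking norms gives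
  \<open>P\<^sub>p(y\<^sup>p) = P(y)\<^sup>p + p E\<close>, where \<open>E\<close> depends polynomially on the coefficients of \<open>P\<close>. Over the
  integers this shows that \<open>P\<^sub>p\<close> and \<open>P\<close> agree modulo \<open>p\<close>, and that if \<open>P\<close> and \<open>R\<close> agree modulo \<open>p\<^sup>j\<close> with
  \<open>j > 0\<close>, then \<open>P\<^sub>p\<close> and \<open>R\<^sub>p\<close> agree modulo \<open>p\<^sup>j\<^sup>+\<^sup>1\<close>. By induction the polynomials with indices
  \<open>m p\<^sup>k\<^sup>+\<^sup>1\<close> and \<open>m p\<^sup>k\<close> agree modulo \<open>p\<^sup>k\<^sup>+\<^sup>1\<close>. Pairing the divisors \<open>e\<close> and \<open>p e\<close> in the Moebius sum
  turns these congruences into divisibility by each prime power dividing \<open>n\<close>.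
\<close>

hide_const (open) Module.smult

section \<open>The norm of \<open>K[x]/(P)\<close>\<close>

text \<open>Meaningful only for monic \<open>P\<close>, where \<open>pseudo_mod\<close> is the true remainder: the matrix of
  multiplication by \<open>G\<close> on \<open>K[x]/(P)\<close>.\<close>

definition mult_mat :: "'a::idom poly \<Rightarrow> 'a poly \<Rightarrow> 'a mat" where
  "mult_mat P G = mat (degree P) (degree P) (\<lambda>(i, j). coeff (pseudo_mod (monom 1 j * G) P) i)"

definition quotient_norm :: "'a::idom poly \<Rightarrow> 'a poly \<Rightarrow> 'a" where
  "quotient_norm P G = det (mult_mat P G)"

lemma mult_mat_carrier [simp]: "mult_mat P G \<in> carrier_mat (degree P) (degree P)"
  by (simp add: mult_mat_def)

section \<open>Division with remainder by a monic polynomial\<close>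

lemma pseudo_mod_monic:
  fixes P :: "'a::idom poly"
  assumes "lead_coeff P = 1"
  obtains q where "G = P * q + pseudo_mod G P"
proof -
  have "P \<noteq> 0" using assms by auto
  moreover obtain q r where "pseudo_divmod G P = (q, r)" by (cases "pseudo_divmod G P")
  ultimately have "G = P * q + pseudo_mod G P"
    using pseudo_divmod(1)[of P G q r] assms by (simp add: pseudo_mod_def)
  then show ?thesis using that by blast
qed

lemma coeff_pseudo_mod_monic_eq_0:
  fixes P :: "'a::idom poly"
  assumes "lead_coeff P = 1" "i \<ge> degree P"
  shows "coeff (pseudo_mod G P) i = 0"
proof -
  have "P \<noteq> 0" using assms by auto
  then have "pseudo_mod G P = 0 \<or> degree (pseudo_mod G P) < degree P"
    by (rule pseudo_mod(2))
  then show ?thesis using assms by (auto intro: coeff_eq_0)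
qed

text \<open>Two remainders differ by a multiple of \<open>P\<close> that is too small in degree
  unless it is 0. Bounding coefficients instead of the degree also covers
  \<open>degree P = 0\<close>, where the remainder is 0.\<close>

lemma pseudo_mod_monic_unique:
  fixes P :: "'a::idom poly"
  assumes P: "lead_coeff P = 1" and G: "G = P * q + r" and r: "\<And>i. i \<ge> degree P \<Longrightarrow> coeff r i = 0"
  shows "pseudo_mod G P = r"
proof -
  obtain q' where q': "G = P * q' + pseudo_mod G P" using pseudo_mod_monic[OF P] .
  define s where "s = r - pseudo_mod G P"
  have s: "coeff s i = 0" if "i \<ge> degree P" for i
    using that r coeff_pseudo_mod_monic_eq_0[OF P that] by (simp add: s_def)
  have eq: "s = P * (q' - q)" unfolding s_def using q' G by (simp add: algebra_simps)
  have "s = 0"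
  proof (rule ccontr)
    assume "s \<noteq> 0"
    then have "degree s \<ge> degree P" using eq by (auto simp: degree_mult_eq)
    then have "lead_coeff s = 0" using s by blast
    then show False using \<open>s \<noteq> 0\<close> by simp
  qed
  then show ?thesis by (simp add: s_def)
qed

lemma pseudo_mod_monic_small:
  fixes P :: "'a::idom poly"
  assumes "lead_coeff P = 1" "\<And>i. i \<ge> degree P \<Longrightarrow> coeff r i = 0"
  shows "pseudo_mod r P = r"
  by (rule pseudo_mod_monic_unique[where q = 0]) (use assms in auto)

lemma pseudo_mod_monic_add:
  fixes P :: "'a::idom poly"
  assumes P: "lead_coeff P = 1"
  shows "pseudo_mod (F + G) P = pseudo_mod F P + pseudo_mod G P"
proof -
  obtain q1 q2 where "F = P * q1 + pseudo_mod F P" "G = P * q2 + pseudo_mod G P"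
    using pseudo_mod_monic[OF P] by metis
  then have "F + G = P * (q1 + q2) + (pseudo_mod F P + pseudo_mod G P)"
    by (simp add: algebra_simps)
  then show ?thesis
    by (rule pseudo_mod_monic_unique[OF P]) (simp add: coeff_pseudo_mod_monic_eq_0[OF P])
qed

lemma pseudo_mod_monic_smult:
  fixes P :: "'a::idom poly"
  assumes P: "lead_coeff P = 1"
  shows "pseudo_mod (smult c G) P = smult c (pseudo_mod G P)"
proof -
  obtain q where q: "G = P * q + pseudo_mod G P"
    using pseudo_mod_monic[OF P] by metis
  have "smult c G = P * smult c q + smult c (pseudo_mod G P)"
    by (subst q) (simp add: smult_add_right)
  then show ?thesis
    by (rule pseudo_mod_monic_unique[OF P]) (simp add: coeff_pseudo_mod_monic_eq_0[OF P])
qed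

lemma pseudo_mod_monic_sum:
  fixes P :: "'a::idom poly"
  assumes P: "lead_coeff P = 1"
  shows "pseudo_mod (\<Sum>i\<in>A. f i) P = (\<Sum>i\<in>A. pseudo_mod (f i) P)"
  by (induction A rule: infinite_finite_induct)
    (simp_all add: pseudo_mod_monic_add[OF P] pseudo_mod_monic_small[OF P])

lemma pseudo_mod_monic_mult_right:
  fixes P :: "'a::idom poly"
  assumes P: "lead_coeff P = 1"
  shows "pseudo_mod (F * pseudo_mod G P) P = pseudo_mod (F * G) P"
proof -
  obtain q where q: "G = P * q + pseudo_mod G P"
    using pseudo_mod_monic[OF P] by metis
  obtain q' where q': "F * pseudo_mod G P = P * q' + pseudo_mod (F * pseudo_mod G P) P"
    using pseudo_mod_monic[OF P] by metis
  have "F * G = P * (F * q) + F * pseudo_mod G P" by (subst q) (simp add: algebra_simps)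
  then have "F * G = P * (F * q + q') + pseudo_mod (F * pseudo_mod G P) P"
    using q' by (simp add: algebra_simps)
  then show ?thesis
    by (rule pseudo_mod_monic_unique[OF P _ coeff_pseudo_mod_monic_eq_0[OF P], symmetric])
qed

text \<open>Reduction modulo \<open>P\<close> is linear, so expanding the remainder of
  \<open>x^j G\<close> in powers of \<open>x\<close> expresses column \<open>j\<close> of the left
  side through the columns for \<open>F\<close>.\<close>

lemma mult_mat_mult:
  fixes P :: "'a::idom poly"
  assumes P: "lead_coeff P = 1"
  shows "mult_mat P (F * G) = mult_mat P F * mult_mat P G"
proof (rule eq_matI)
  let ?d = "degree P"
  fix i j assume "i < dim_row (mult_mat P F * mult_mat P G)" "j < dim_col (mult_mat P F * mult_mat P G)"
  then have ij: "i < ?d" "j < ?d" by (simp_all add: mult_mat_def)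
  define r where "r = pseudo_mod (monom 1 j * G) P"
  have r: "r = (\<Sum>k<?d. smult (coeff r k) (monom 1 k))"
  proof (rule poly_eqI)
    fix n show "coeff r n = coeff (\<Sum>k<?d. smult (coeff r k) (monom 1 k)) n"
    proof (cases "n < ?d")
      case True
      then show ?thesis by (simp add: coeff_sum smult_monom if_distrib sum.delta' cong: if_cong)
    next
      case False
      then show ?thesis using coeff_pseudo_mod_monic_eq_0[OF P, of n]
        by (simp add: coeff_sum smult_monom r_def if_distrib cong: if_cong)
    qed
  qed
  have "pseudo_mod (monom 1 j * (F * G)) P = pseudo_mod (F * r) P"
    unfolding r_def pseudo_mod_monic_mult_right[OF P] by (simp add: algebra_simps)
  also have "F * r = (\<Sum>k<?d. smult (coeff r k) (monom 1 k * F))"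
    by (subst r) (simp add: sum_distrib_left mult.commute)
  finally have "coeff (pseudo_mod (monom 1 j * (F * G)) P) i
      = (\<Sum>k<?d. coeff r k * coeff (pseudo_mod (monom 1 k * F) P) i)"
    by (simp add: pseudo_mod_monic_sum[OF P] pseudo_mod_monic_smult[OF P] coeff_sum)
  then show "mult_mat P (F * G) $$ (i, j) = (mult_mat P F * mult_mat P G) $$ (i, j)"
    using ij by (simp add: mult_mat_def scalar_prod_def r_def atLeast0LessThan mult.commute)
qed (simp_all add: mult_mat_def)

lemma quotient_norm_mult:
  assumes "lead_coeff P = 1"
  shows "quotient_norm P (F * G) = quotient_norm P F * quotient_norm P G"
  by (simp add: quotient_norm_def mult_mat_mult[OF assms] det_mult[of _ "degree P"])

lemma quotient_norm_const:
  assumes P: "lead_coeff P = 1"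
  shows "quotient_norm P [:c:] = c ^ degree P"
proof -
  have "pseudo_mod (monom 1 j * [:c:]) P = monom c j" if "j < degree P" for j
    using that by (simp add: smult_monom pseudo_mod_monic_small[OF P])
  then have "mult_mat P [:c:] = c \<cdot>\<^sub>m 1\<^sub>m (degree P)"
    by (intro eq_matI) (auto simp: mult_mat_def)
  then show ?thesis by (simp add: quotient_norm_def)
qed

lemma quotient_norm_power:
  assumes P: "lead_coeff P = 1"
  shows "quotient_norm P (G ^ k) = quotient_norm P G ^ k"
  by (induction k) (use quotient_norm_const[OF P, of 1] in \<open>simp_all add: quotient_norm_mult[OF P] flip: one_pCons\<close>)

section \<open>The norm under ring homomorphisms and congruences\<close>

lemma monic_map_poly:
  assumes "comm_ring_hom h" "lead_coeff P = 1"
  shows "degree (map_poly h P) = degree P" "lead_coeff (map_poly h P) = 1"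
proof -
  interpret comm_ring_hom h by fact
  have "coeff (map_poly h P) (degree P) = 1" using assms by simp
  moreover have "degree (map_poly h P) \<le> degree P" by (rule degree_map_poly_le)
  ultimately show "degree (map_poly h P) = degree P"
    by (metis le_antisym le_degree zero_neq_one)
  then show "lead_coeff (map_poly h P) = 1" using assms by simp
qed

text \<open>The image of a division by \<open>P\<close> is a division by the image of
  \<open>P\<close>, since that is monic of the same degree; determinants commute with
  homomorphisms.\<close>

lemma quotient_norm_hom:
  assumes h: "comm_ring_hom h" and P: "lead_coeff P = 1"
  shows "quotient_norm (map_poly h P) (map_poly h G) = h (quotient_norm P G)"
proof -
  interpret comm_ring_hom h by fact
  interpret map_poly_hom: map_poly_comm_ring_hom h ..
  have "pseudo_mod (map_poly h F) (map_poly h P) = map_poly h (pseudo_mod F P)" for F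
  proof -
    obtain q where q: "F = P * q + pseudo_mod F P"
      using pseudo_mod_monic[OF P] by metis
    show ?thesis
    proof (rule pseudo_mod_monic_unique[where q = "map_poly h q"])
      show "map_poly h F = map_poly h P * map_poly h q + map_poly h (pseudo_mod F P)"
        by (subst q) (simp add: hom_distribs)
    qed (use monic_map_poly[OF h P] coeff_pseudo_mod_monic_eq_0[OF P] in auto)
  qed
  from this[of "monom 1 _ * G"] have "mult_mat (map_poly h P) (map_poly h G) = map_mat h (mult_mat P G)"
    by (intro eq_matI) (auto simp: mult_mat_def monic_map_poly(1)[OF h P] hom_distribs)
  then show ?thesis by (simp add: quotient_norm_def)
qed

lemma dvd_prod_diff:
  fixes c :: "'a::comm_ring_1"
  assumes "\<And>i. i \<in> A \<Longrightarrow> c dvd f i - g i"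
  shows "c dvd prod f A - prod g A"
  using assms
proof (induction A rule: infinite_finite_induct)
  case (insert x F)
  have "prod f (insert x F) - prod g (insert x F)
      = (f x - g x) * prod f F + g x * (prod f F - prod g F)"
    using insert by (simp add: algebra_simps)
  then show ?case using insert by simp
qed auto

text \<open>By the Leibniz formula the determinant is an integer polynomial in the entries.\<close>

lemma dvd_det_diff:
  assumes "A \<in> carrier_mat n n" "B \<in> carrier_mat n n"
    and "\<And>i j. i < n \<Longrightarrow> j < n \<Longrightarrow> c dvd A $$ (i, j) - B $$ (i, j)"
  shows "c dvd det A - det B"
  unfolding det_def'[OF assms(1)] det_def'[OF assms(2)] sum_subtractf[symmetric] right_diff_distrib[symmetric]
  by (intro dvd_sum dvd_mult dvd_prod_diff assms(3)) (auto simp: permutes_in_image)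

lemma quotient_norm_cong:
  assumes P: "lead_coeff P = 1" and FG: "[:c:] dvd F - G"
  shows "c dvd quotient_norm P F - quotient_norm P G"
proof -
  obtain H where "F = G + smult c H" using FG by (auto simp: dvd_def algebra_simps)
  then show ?thesis unfolding quotient_norm_def
    by (intro dvd_det_diff[where n = "degree P"])
      (auto simp: mult_mat_def algebra_simps pseudo_mod_monic_add[OF P] pseudo_mod_monic_smult[OF P])
qed

text \<open>Adding \<open>b\<^sup>i\<close> times row \<open>i\<close> to row \<open>0\<close>, for all \<open>i > 0\<close>, turns row \<open>0\<close> into the values at \<open>b\<close> of
  the remainders of \<open>x\<^sup>j (x - b)\<close>; only the last of these is nonzero.\<close>

lemma quotient_norm_linear:
  assumes P: "lead_coeff P = 1"
  shows "quotient_norm P [:-b, 1:] = (-1) ^ degree P * poly P b"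
proof (cases "degree P")
  case 0
  then obtain a where "P = [:a:]" by (rule degree_eq_zeroE)
  then show ?thesis using P by (simp add: quotient_norm_def mult_mat_def)
next
  case (Suc d)
  let ?L = "[:-b, 1:]" and ?n = "degree P"
  define R where "R j = pseudo_mod (monom 1 j * ?L) P" for j
  have shift: "monom 1 j * ?L = monom 1 (Suc j) - monom b j" for j
    by (intro poly_eqI) (simp add: coeff_monom_mult coeff_pCons split: nat.split)
  have R_small: "R j = monom 1 (Suc j) - monom b j" if "j < d" for j
    unfolding R_def shift using that Suc by (intro pseudo_mod_monic_small[OF P]) auto
  \<comment> \<open>Here \<open>x^(d+1)\<close> reaches the degree of \<open>P\<close>, so
    \<open>P\<close> is subtracted once and the value at \<open>b\<close> is
    \<open>- poly P b\<close>.\<close>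
  have R_last: "R d = monom 1 (Suc d) - monom b d - P" unfolding R_def shift
  proof (rule pseudo_mod_monic_unique[OF P, where q = 1])
    fix i assume "?n \<le> i"
    then show "coeff (monom 1 (Suc d) - monom b d - P) i = 0"
      using P Suc by (cases "i = ?n") (auto simp: coeff_eq_0)
  qed simp
  define V where "V = mat ?n ?n (\<lambda>(i, j). if i = 0 then b ^ j else if i = j then 1 else 0)"
  define W where "W = V * mult_mat P ?L"
  have V: "V \<in> carrier_mat ?n ?n" by (simp add: V_def)
  have W: "W \<in> carrier_mat ?n ?n" unfolding W_def by (rule mult_carrier_mat[OF V]) simp
  have "det V = prod_list (diag_mat V)"
    by (intro det_upper_triangular[of _ ?n]) (auto simp: V_def)
  also have "diag_mat V = map (\<lambda>i. 1) [0..<?n]"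
    unfolding diag_mat_def by (intro map_cong) (auto simp: V_def)
  finally have det_V: "det V = 1" by (simp add: map_replicate_const prod_list_replicate)
  have evalR: "(\<Sum>k<?n. b ^ k * coeff (R j) k) = poly (R j) b" for j
  proof -
    have "(\<Sum>k<?n. b ^ k * coeff (R j) k) = (\<Sum>k\<in>{..<?n} \<union> {..degree (R j)}. coeff (R j) k * b ^ k)"
      by (intro sum.mono_neutral_cong_left)
        (auto simp: R_def mult.commute coeff_pseudo_mod_monic_eq_0[OF P] not_less)
    also have "\<dots> = poly (R j) b" unfolding poly_altdef
      by (intro sum.mono_neutral_right) (auto simp: coeff_eq_0)
    finally show ?thesis .
  qed
  have M: "mult_mat P ?L = mat ?n ?n (\<lambda>(i, j). coeff (R j) i)"
    unfolding mult_mat_def R_def ..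
  have W_eq: "W $$ (i, j) = (\<Sum>k<?n. V $$ (i, k) * coeff (R j) k)" if "i < ?n" "j < ?n" for i j
    using that by (simp add: W_def M V_def scalar_prod_def atLeast0LessThan)
  have W0: "W $$ (0, j) = poly (R j) b" if "j < ?n" for j
    unfolding evalR[symmetric] using that by (subst W_eq) (auto simp: V_def)
  have Wi: "W $$ (i, j) = coeff (R j) i" if "0 < i" "i < ?n" "j < ?n" for i j
  proof -
    have "W $$ (i, j) = (\<Sum>k<?n. if i = k then coeff (R j) k else 0)"
      unfolding W_eq[OF that(2,3)] by (intro sum.cong) (use that in \<open>auto simp: V_def\<close>)
    then show ?thesis using that by simp
  qed
  have "det W = (\<Sum>j<?n. W $$ (0, j) * cofactor W 0 j)"
    by (rule laplace_expansion_row[OF W]) (simp add: Suc)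
  also have "\<dots> = (\<Sum>j\<in>{d}. W $$ (0, j) * cofactor W 0 j)"
    by (intro sum.mono_neutral_right)
      (use Suc in \<open>auto simp: W0 R_small poly_monom\<close>)
  also have "\<dots> = - poly P b * cofactor W 0 d"
    using Suc by (simp add: W0 R_last poly_monom)
  also have "cofactor W 0 d = (-1) ^ d * det (mat_delete W 0 d)" by (simp add: cofactor_def)
  \<comment> \<open>With row 0 gone, the coefficient 1 of \<open>x^(j+1)\<close> in
    \<open>R j\<close> lands on the diagonal and \<open>-b\<close> just above it.\<close>
  also have "det (mat_delete W 0 d) = prod_list (diag_mat (mat_delete W 0 d))"
    using Suc W by (intro det_upper_triangular[of _ d])
      (auto simp: mat_delete_def Wi R_small)
  also have "diag_mat (mat_delete W 0 d) = map (\<lambda>i. 1) [0..<d]"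
    unfolding diag_mat_def using W Suc
    by (intro map_cong) (auto simp: mat_delete_def Wi R_small)
  also have "prod_list \<dots> = 1" by (simp add: map_replicate_const prod_list_replicate)
  finally have "det W = (-1) ^ ?n * poly P b" by (simp add: Suc)
  moreover have "det W = det V * quotient_norm P ?L"
    unfolding W_def quotient_norm_def by (rule det_mult[OF V]) simp
  ultimately show ?thesis by (simp add: det_V)
qed

section \<open>The norm as a product over roots\<close>

lemma poly_prod_linear: "poly (\<Prod>a\<in>#A. [:-f a, 1:]) x = (\<Prod>a\<in>#A. x - f a)"
  for x :: "'a::comm_ring_1"
  by (induction A) (simp_all add: algebra_simps)

lemma quotient_norm_prod_linear:
  assumes P: "lead_coeff P = 1"
  shows "quotient_norm P (\<Prod>b\<in>#B. [:-b, 1:]) = (\<Prod>b\<in>#B. (-1) ^ degree P * poly P b)"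
proof (induction B)
  case empty
  show ?case using quotient_norm_const[OF P, of 1] by (simp flip: one_pCons)
qed (simp add: quotient_norm_mult[OF P] quotient_norm_linear[OF P] del: mult_pCons_left)

lemma monic_complex_poly_decompose:
  fixes P :: "complex poly"
  assumes "lead_coeff P = 1"
  shows "(\<Prod>a\<in>#proots P. [:-a, 1:]) = P"
  using complex_poly_decompose_multiset[of P] assms by simp

lemma prod_mset_diff_commute:
  "(\<Prod>a\<in>#A. a - b) = (-1) ^ size A * (\<Prod>a\<in>#A. b - a)" for b :: "'a::comm_ring_1"
  by (induction A) (simp_all add: algebra_simps)

text \<open>Splitting \<open>G\<close> into linear factors gives a product over the roots of
  \<open>G\<close>; interchanging the two products gives one over the roots of
  \<open>P\<close>.\<close>

lemma quotient_norm_complex: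
  fixes P :: "complex poly"
  assumes P: "lead_coeff P = 1"
  shows "quotient_norm P G = (\<Prod>a\<in>#proots P. poly G a)"
proof -
  let ?A = "proots P" and ?B = "proots G" and ?d = "degree P"
  have swap: "(-1) ^ ?d * poly P b = (\<Prod>a\<in>#?A. a - b)" for b
  proof -
    have "poly P b = (\<Prod>a\<in>#?A. b - a)"
      by (subst monic_complex_poly_decompose[OF P, symmetric]) (rule poly_prod_linear)
    then show ?thesis by (simp add: prod_mset_diff_commute size_proots_complex)
  qed
  have "poly G a = lead_coeff G * (\<Prod>b\<in>#?B. a - b)" for a
    by (subst complex_poly_decompose_multiset[symmetric]) (simp only: poly_smult poly_prod_linear)
  then have "(\<Prod>a\<in>#?A. poly G a) = lead_coeff G ^ ?d * (\<Prod>a\<in>#?A. \<Prod>b\<in>#?B. a - b)"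
    by (simp add: prod_mset.distrib size_proots_complex)
  also have "(\<Prod>a\<in>#?A. \<Prod>b\<in>#?B. a - b) = quotient_norm P (\<Prod>b\<in>#?B. [:-b, 1:])"
    by (subst prod_mset.swap) (simp add: quotient_norm_prod_linear[OF P] swap)
  also have "lead_coeff G ^ ?d * \<dots> = quotient_norm P ([:lead_coeff G:] * (\<Prod>b\<in>#?B. [:-b, 1:]))"
    by (simp only: quotient_norm_mult[OF P] quotient_norm_const[OF P])
  also have "[:lead_coeff G:] * (\<Prod>b\<in>#?B. [:-b, 1:]) = G"
    by (simp add: complex_poly_decompose_multiset)
  finally show ?thesis ..
qed

section \<open>Polynomials with powered roots over an arbitrary domain\<close>

text \<open>The norm of \<open>y - x\<^sup>k\<close> from \<open>K[y][x]/(P)\<close>, that is, the characteristic polynomial of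
  multiplication by \<open>x\<^sup>k\<close> on \<open>K[x]/(P)\<close>. Its roots are the \<open>k\<close>-th powers of the roots of \<open>P\<close>.\<close>

definition root_power :: "'a::idom poly \<Rightarrow> nat \<Rightarrow> 'a poly" where
  "root_power P k = quotient_norm (map_poly (\<lambda>c. [:c:]) P) ([:[:0, 1:]:] - monom 1 k)"

lemma comm_ring_hom_const_poly: "comm_ring_hom (\<lambda>c :: 'a::comm_ring_1. [:c:])"
  by unfold_locales (simp_all add: one_pCons)

lemma root_power_hom:
  assumes h: "comm_ring_hom h" and P: "lead_coeff P = 1"
  shows "map_poly h (root_power P k) = root_power (map_poly h P) k"
proof -
  interpret comm_ring_hom h by fact
  interpret map_poly_hom: map_poly_comm_ring_hom h ..
  interpret map_poly_hom2: map_poly_comm_ring_hom "map_poly h" ..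
  have "map_poly (\<lambda>c. [:c:]) (map_poly h P) = map_poly (map_poly h) (map_poly (\<lambda>c. [:c:]) P)"
    by (intro poly_eqI) (simp add: coeff_map_poly hom_distribs)
  moreover have "[:[:0, 1:]:] - monom 1 k = map_poly (map_poly h) ([:[:0, 1:]:] - monom 1 k)"
    by (simp add: hom_distribs)
  ultimately show ?thesis unfolding root_power_def
    using quotient_norm_hom[OF map_poly_hom.comm_ring_hom_axioms monic_map_poly(2)[OF comm_ring_hom_const_poly P]]
    by metis
qed

text \<open>Evaluation at \<open>y = z\<close> is a ring homomorphism, so the value at
  \<open>z\<close> is the norm of \<open>z - x^k\<close>, the product of all
  \<open>z - a^k\<close>.\<close>

lemma root_power_complex:
  fixes P :: "complex poly"
  assumes P: "lead_coeff P = 1"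
  shows "root_power P k = (\<Prod>a\<in>#proots P. [:-(a ^ k), 1:])"
proof -
  have "poly (root_power P k) z = poly (\<Prod>a\<in>#proots P. [:-(a ^ k), 1:]) z" for z
  proof -
    have "poly (root_power P k) z
        = quotient_norm (map_poly (\<lambda>p. poly p z) (map_poly (\<lambda>c. [:c:]) P))
            (map_poly (\<lambda>p. poly p z) ([:[:0, 1:]:] - monom 1 k))"
      unfolding root_power_def
      by (rule quotient_norm_hom[OF poly_hom.comm_ring_hom_axioms
            monic_map_poly(2)[OF comm_ring_hom_const_poly P], symmetric])
    also have "map_poly (\<lambda>p. poly p z) (map_poly (\<lambda>c. [:c:]) P) = P"
      by (intro poly_eqI) (simp add: coeff_map_poly)
    also have "map_poly (\<lambda>p. poly p z) ([:[:0, 1:]:] - monom 1 k) = [:z:] - monom 1 k"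
      by (intro poly_eqI) (simp add: coeff_map_poly coeff_pCons split: nat.split)
    finally show ?thesis
      by (simp add: quotient_norm_complex[OF P] poly_prod_linear poly_monom)
  qed
  then show ?thesis by (simp add: poly_eq_poly_eq_iff[symmetric] fun_eq_iff)
qed

section \<open>Integer polynomials, their complex roots and resultants\<close>

lemma monic_complex_poly:
  assumes "lead_coeff P = 1"
  shows "lead_coeff (complex_poly P) = 1"
  using assms by simp

text \<open>Gives \<open>root_power_poly P k\<close> integer coefficients. Identities between
  integer polynomials can now be checked on complex roots and pulled back by injectivity.\<close>

lemma complex_poly_root_power:
  assumes "lead_coeff P = 1"
  shows "complex_poly (root_power P k) = root_power_poly P k"
  unfolding root_power_poly_def
  by (simp only: root_power_hom[OF of_int_hom.comm_ring_hom_axioms assms]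
      root_power_complex[OF monic_complex_poly[OF assms]])

lemma proots_prod_linear: "proots (\<Prod>a\<in>#A. [:-f a, 1:]) = image_mset f (A :: 'b multiset)"
  for f :: "'b \<Rightarrow> 'a::idom"
proof (induction A)
  case (add x A)
  have "(\<Prod>a\<in>#A. [:-f a, 1:]) \<noteq> 0" by (auto simp: prod_mset_zero_iff)
  then have "proots ([:-f x, 1:] * (\<Prod>a\<in>#A. [:-f a, 1:])) = proots [:-f x, 1:] + proots (\<Prod>a\<in>#A. [:-f a, 1:])"
    by (intro proots_mult) auto
  then show ?case using add by (simp del: mult_pCons_left)
qed simp

lemma proots_root_power_poly:
  "proots (root_power_poly P k) = image_mset (\<lambda>a. a ^ k) (proots (complex_poly P))"
  unfolding root_power_poly_def by (rule proots_prod_linear)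

lemma monic_root_power_poly: "lead_coeff (root_power_poly P k) = 1"
proof -
  have "lead_coeff (\<Prod>a\<in>#A. [:-f a, 1:]) = 1" for A :: "complex multiset" and f :: "complex \<Rightarrow> complex"
    by (induction A) (simp_all add: lead_coeff_mult del: mult_pCons_left)
  then show ?thesis by (simp add: root_power_poly_def)
qed

lemma degree_root_power:
  fixes P :: "int poly"
  assumes "lead_coeff P = 1"
  shows "degree (root_power P k) = degree P"
proof -
  have "degree (complex_poly (root_power P k)) = degree (complex_poly P)"
    unfolding complex_poly_root_power[OF assms]
    by (simp flip: size_proots_complex add: proots_root_power_poly)
  then show ?thesis by simp
qed

lemma lead_coeff_root_power:
  fixes P :: "int poly"
  assumes "lead_coeff P = 1"
  shows "lead_coeff (root_power P k) = 1"
  using monic_root_power_poly[of P k]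
  unfolding complex_poly_root_power[OF assms, symmetric] by simp

lemma root_power_1:
  fixes P :: "int poly"
  assumes P: "lead_coeff P = 1"
  shows "root_power P 1 = P"
proof -
  have "complex_poly (root_power P 1) = complex_poly P"
    unfolding complex_poly_root_power[OF P] root_power_poly_def
    using monic_complex_poly_decompose[OF monic_complex_poly[OF P]] by simp
  then show ?thesis by (simp only: of_int_poly_hom.eq_iff)
qed

lemma root_power_root_power:
  fixes P :: "int poly"
  assumes P: "lead_coeff P = 1"
  shows "root_power (root_power P k) l = root_power P (k * l)"
proof -
  have "complex_poly (root_power (root_power P k) l) = complex_poly (root_power P (k * l))"
    unfolding complex_poly_root_power[OF P] complex_poly_root_power[OF lead_coeff_root_power[OF P]]
    by (simp add: root_power_poly_def[of _ l] root_power_poly_def[of _ "k * l"]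
        complex_poly_root_power[OF P] proots_root_power_poly multiset.map_comp o_def power_mult)
  then show ?thesis by (simp only: of_int_poly_hom.eq_iff)
qed

text \<open>Grouping the factors by the roots of \<open>Q\<close> gives a norm from
  \<open>Q\<close>, with one sign \<open>(-1) ^ degree P\<close> for each root; the total sign is
  independent of \<open>m\<close>.\<close>

lemma monic_resultant_root_power_poly:
  assumes P: "lead_coeff P = 1" and Q: "lead_coeff Q = 1"
  shows "monic_resultant (root_power_poly P m) (complex_poly Q)
    = of_int ((-1) ^ (degree P * degree Q) * quotient_norm Q (root_power P m))"
proof -
  let ?A = "root_power_poly P m" and ?B = "complex_poly Q"
  have A: "lead_coeff ?A = 1" by (rule monic_root_power_poly)
  have B: "lead_coeff ?B = 1" by (rule monic_complex_poly[OF Q])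
  have "monic_resultant ?A ?B = (\<Prod>a\<in>#proots ?A. \<Prod>b\<in>#proots ?B. a - b)"
    by (simp add: monic_resultant_def)
  also have "\<dots> = (\<Prod>b\<in>#proots ?B. \<Prod>a\<in>#proots ?A. a - b)"
    by (rule prod_mset.swap)
  also have "\<dots> = (\<Prod>b\<in>#proots ?B. (-1) ^ size (proots ?A) * poly ?A b)"
  proof -
    have "(\<Prod>a\<in>#proots ?A. b - a) = poly ?A b" for b
      by (subst (2) monic_complex_poly_decompose[OF A, symmetric]) (rule poly_prod_linear[symmetric])
    then show ?thesis by (simp add: prod_mset_diff_commute)
  qed
  also have "\<dots> = (-1) ^ (degree P * degree Q) * quotient_norm ?B ?A"
    by (simp add: prod_mset.distrib quotient_norm_complex[OF B] size_proots_complex power_mult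
        flip: complex_poly_root_power[OF P]) (simp add: degree_root_power[OF P])
  also have "quotient_norm ?B ?A = of_int (quotient_norm Q (root_power P m))"
    unfolding complex_poly_root_power[OF P, symmetric]
    by (rule quotient_norm_hom[OF of_int_hom.comm_ring_hom_axioms Q])
  finally show ?thesis by simp
qed

section \<open>Congruences modulo prime powers\<close>

lemma prime_dvd_add_power:
  fixes a b :: "'a::comm_ring_1"
  assumes p: "prime p"
  shows "of_nat p dvd (a + b) ^ p - (a ^ p + b ^ p)"
proof -
  have p1: "p > 1" using p by (rule prime_gt_1_nat)
  define f where "f k = of_nat (p choose k) * a ^ k * b ^ (p - k)" for k
  have "(a + b) ^ p = (\<Sum>k\<le>p. f k)" unfolding f_def by (rule binomial_ring)
  also have "\<dots> = (\<Sum>k\<in>{0, p}. f k) + (\<Sum>k\<in>{..p} - {0, p}. f k)"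
    by (subst sum.subset_diff[of "{0, p}"]) (auto simp: add.commute)
  also have "(\<Sum>k\<in>{0, p}. f k) = a ^ p + b ^ p" using p1 by (simp add: f_def add.commute)
  finally have "(a + b) ^ p - (a ^ p + b ^ p) = (\<Sum>k\<in>{..p} - {0, p}. f k)" by simp
  moreover have "of_nat p dvd f k" if "k \<in> {..p} - {0, p}" for k
    unfolding f_def using that p1 dvd_choose_prime[of k p] p
    by (intro dvd_mult2) (auto simp: dvd_def)
  ultimately show ?thesis by (simp only: dvd_sum)
qed

lemma prime_dvd_diff_power:
  fixes a b :: "'a::comm_ring_1"
  assumes p: "prime p"
  shows "of_nat p dvd (a - b) ^ p - (a ^ p - b ^ p)"
proof (cases "odd p")
  case True
  then show ?thesis using prime_dvd_add_power[OF p, of a "-b"] by simp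
next
  \<comment> \<open>For \<open>p = 2\<close> replacing \<open>b\<close> by \<open>-b\<close> does
    not change the sign of \<open>b ^ p\<close>, so the difference is computed directly.\<close>
  case False
  then have [simp]: "p = 2" using primes_dvd_imp_eq[OF two_is_prime_nat p] by simp
  have "(a - b) ^ p - (a ^ p - b ^ p) = of_nat p * (b * b - a * b)"
    by (simp add: power2_eq_square algebra_simps)
  then show ?thesis by simp
qed

lemma prime_dvd_int_power_diff:
  assumes p: "prime p"
  shows "int p dvd a ^ p - a"
proof (induction a rule: int_induct[where k = 0])
  case base
  show ?case using p by (simp add: power_0_left prime_gt_0_nat)
next
  case (step1 i)
  show ?case using dvd_add[OF prime_dvd_add_power[OF p, of i 1] step1(2)] by (simp add: algebra_simps)
next
  case (step2 i)
  show ?case using dvd_add[OF prime_dvd_diff_power[OF p, of i 1] step2(2)] by (simp add: algebra_simps)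
qed

text \<open>Modulo \<open>p\<close> the \<open>p\<close>-th power is additive and, by Fermat's
  little theorem, fixes the coefficients.\<close>

lemma prime_dvd_pcompose_diff_power:
  fixes f :: "int poly"
  assumes p: "prime p"
  shows "of_nat p dvd f \<circ>\<^sub>p monom 1 p - f ^ p"
proof (induction f)
  case 0
  show ?case using p by (simp add: power_0_left prime_gt_0_nat)
next
  case (pCons a f)
  have f: "pCons a f = [:a:] + monom 1 1 * f" by (simp add: monom_Suc)
  have pow: "pCons a f ^ p = ([:a:] + monom 1 1 * f) ^ p" by (simp only: f)
  have const: "[:a ^ p - a:] = [:a:] ^ p - [:a:]" by (simp add: poly_const_pow)
  have mult: "(monom 1 1 * f) ^ p = monom 1 p * f ^ p" by (simp only: power_mult_distrib x_pow_n)
  have eq: "pCons a f \<circ>\<^sub>p monom 1 p - pCons a f ^ p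
      = monom 1 p * (f \<circ>\<^sub>p monom 1 p - f ^ p) - [:a ^ p - a:]
        - (([:a:] + monom 1 1 * f) ^ p - ([:a:] ^ p + (monom 1 1 * f) ^ p))"
    unfolding pow const mult pcompose_pCons right_diff_distrib by simp
  have "of_nat p dvd [:a ^ p - a:]"
    using prime_dvd_int_power_diff[OF p, of a] by (simp add: of_nat_poly)
  then show ?case unfolding eq by (intro dvd_diff dvd_mult pCons.IH prime_dvd_add_power[OF p])
qed

text \<open>In the expansion of \<open>(b + (a - b)) ^ p\<close> the linear term contains
  \<open>p * (a - b)\<close> and the rest \<open>(a - b)^2\<close>; both are multiples of
  \<open>c * p\<close> because \<open>p\<close> divides \<open>c\<close>.\<close>

lemma dvd_power_prime_diff:
  fixes a b c :: "'a::comm_ring_1"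
  assumes c: "c dvd a - b" and p: "of_nat p dvd c"
  shows "c * of_nat p dvd a ^ p - b ^ p"
proof -
  have "\<exists>w. (b + z) ^ n = b ^ n + of_nat n * b ^ (n - 1) * z + z\<^sup>2 * w" for z n
  proof (induction n)
    case (Suc n)
    then obtain w where w: "(b + z) ^ n = b ^ n + of_nat n * b ^ (n - 1) * z + z\<^sup>2 * w" by blast
    have "(b + z) ^ Suc n = b ^ Suc n + of_nat (Suc n) * b ^ n * z
        + z\<^sup>2 * (of_nat n * b ^ (n - 1) + (b + z) * w)"
      unfolding power_Suc w by (cases n) (simp_all add: algebra_simps power2_eq_square)
    then show ?case by auto
  qed (auto intro: exI[of _ 0])
  then obtain w where w: "(b + (a - b)) ^ p = b ^ p + of_nat p * b ^ (p - 1) * (a - b) + (a - b)\<^sup>2 * w"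
    by blast
  then have "a ^ p - b ^ p = ((a - b) * of_nat p) * b ^ (p - 1) + (a - b) * (a - b) * w"
    by (simp add: algebra_simps power2_eq_square)
  moreover have "c * of_nat p dvd (a - b) * of_nat p" using c by (intro mult_dvd_mono) auto
  moreover have "c * of_nat p dvd (a - b) * (a - b)"
    using c p dvd_trans by (intro mult_dvd_mono) auto
  ultimately show ?thesis by simp
qed

text \<open>Substituting \<open>y^p\<close> for \<open>y\<close> turns the norm of
  \<open>y - x^p\<close> into that of \<open>y^p - x^p\<close>, which is congruent to
  \<open>(y - x)^p\<close>. A general domain is allowed so that integer polynomials in a parameter
  can serve as coefficients.\<close>

lemma root_power_prime_cong:
  fixes P :: "'a::idom poly"
  assumes P: "lead_coeff P = 1" and p: "prime p"
  shows "of_nat p dvd root_power P p \<circ>\<^sub>p monom 1 p - root_power P 1 ^ p"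
proof -
  define C where "C = map_poly (\<lambda>c. [:c:]) P"
  define h where "h f = f \<circ>\<^sub>p monom 1 p" for f :: "'a poly"
  have C: "lead_coeff C = 1" unfolding C_def by (rule monic_map_poly(2)[OF comm_ring_hom_const_poly P])
  have h: "comm_ring_hom h" unfolding h_def by (rule pcompose_hom.comm_ring_hom_axioms)
  have hC: "map_poly h C = C"
    by (intro poly_eqI) (simp add: C_def h_def coeff_map_poly)
  have hG: "map_poly h ([:[:0, 1:]:] - monom 1 p) = [:monom 1 p:] - monom 1 p"
    by (intro poly_eqI) (simp add: h_def coeff_map_poly pcompose_diff pcompose_pCons coeff_pCons split: nat.split)
  have "root_power P p \<circ>\<^sub>p monom 1 p = quotient_norm C ([:monom 1 p:] - monom 1 p)"
    using quotient_norm_hom[OF h C, of "[:[:0, 1:]:] - monom 1 p"]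
    unfolding hC hG by (simp add: root_power_def C_def h_def)
  moreover have "root_power P 1 ^ p = quotient_norm C (([:[:0, 1:]:] - monom 1 1) ^ p)"
    by (simp only: root_power_def C_def[symmetric] quotient_norm_power[OF C])
  moreover have "[:of_nat p:] dvd [:monom 1 p:] - monom 1 p - ([:[:0, 1 :: 'a:]:] - monom 1 1) ^ p"
  proof -
    have "[:monom 1 p:] - monom 1 p = [:[:0, 1 :: 'a:]:] ^ p - monom 1 1 ^ p"
      unfolding x_pow_n poly_const_pow by (simp add: monom_altdef)
    then have "of_nat p dvd [:monom 1 p:] - monom 1 p - ([:[:0, 1 :: 'a:]:] - monom 1 1) ^ p"
      using prime_dvd_diff_power[OF p, of "[:[:0, 1 :: 'a:]:]" "monom 1 1"]
      by (metis dvd_minus_iff minus_diff_eq)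
    then show ?thesis by (simp only: of_nat_poly)
  qed
  ultimately show ?thesis by (simp only: quotient_norm_cong[OF C])
qed

text \<open>Coefficient \<open>i\<close> of \<open>f\<close> reappears as coefficient
  \<open>p * i\<close> after the substitution.\<close>

lemma const_poly_dvd_pcompose_monom:
  fixes c :: int
  assumes "[:c:] dvd f \<circ>\<^sub>p monom 1 p" "p > 0"
  shows "[:c:] dvd f"
  using assms coeff_pcompose_x_pow_n[of p f] unfolding const_poly_dvd_iff by (metis not_gr0)

text \<open>Both \<open>P_p(x^p)\<close> and \<open>P(x^p)\<close> are congruent to
  \<open>P(x)^p\<close> modulo \<open>p\<close>.\<close>

lemma root_power_prime_base:
  assumes P: "lead_coeff P = 1" and p: "prime p"
  shows "[:int p:] dvd root_power P p - P"
proof (rule const_poly_dvd_pcompose_monom)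
  have "of_nat p dvd (root_power P p \<circ>\<^sub>p monom 1 p - P ^ p) - (P \<circ>\<^sub>p monom 1 p - P ^ p)"
    by (rule dvd_diff[OF root_power_prime_cong[OF P p, unfolded root_power_1[OF P]]
          prime_dvd_pcompose_diff_power[OF p]])
  then show "[:int p:] dvd (root_power P p - P) \<circ>\<^sub>p monom 1 p"
    by (simp add: of_nat_poly pcompose_diff)
  show "p > 0" using p by (rule prime_gt_0_nat)
qed

text \<open>Interpolating between \<open>P\<close> and \<open>R\<close> by a polynomial over \<open>\<int>[t]\<close>, whose specialisations at
  \<open>t = 0\<close> and \<open>t = c\<close> are \<open>R\<close> and \<open>P\<close>, shows that the quotients
  \<open>(P\<^sub>p(x\<^sup>p) - P(x)\<^sup>p) / p\<close> and \<open>(R\<^sub>p(x\<^sup>p) - R(x)\<^sup>p) / p\<close> agree modulo \<open>c\<close>.\<close>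

lemma root_power_prime_step:
  assumes P: "lead_coeff P = 1" and R: "lead_coeff R = 1" and deg: "degree P = degree R"
    and p: "prime p" and c: "int p dvd c" "c \<noteq> 0" and PR: "[:c:] dvd P - R"
  shows "[:c * int p:] dvd root_power P p - root_power R p"
proof (rule const_poly_dvd_pcompose_monom)
  obtain H where H: "P = R + smult c H" using PR by (auto simp: dvd_def algebra_simps)
  define T :: "int poly poly"
    where "T = map_poly (\<lambda>c. [:c:]) R + smult [:0, 1:] (map_poly (\<lambda>c. [:c:]) H)"
  \<comment> \<open>The leading terms of \<open>P\<close> and \<open>R\<close> cancel, so
    \<open>H\<close> has smaller degree and \<open>T\<close> is monic.\<close>
  have H0: "coeff H i = 0" if "i \<ge> degree R" for i
  proof -
    have "coeff (P - R) i = 0"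
      using that P R deg by (cases "i = degree R") (simp_all add: coeff_eq_0)
    then show ?thesis using c by (simp add: H)
  qed
  have T_deg: "coeff T (degree R) = 1"
    using R by (simp add: T_def coeff_map_poly H0 one_pCons)
  have "degree T \<le> degree R"
    by (rule degree_le) (simp add: T_def coeff_map_poly H0 coeff_eq_0)
  moreover have "degree R \<le> degree T" by (rule le_degree) (simp add: T_deg)
  ultimately have T: "lead_coeff T = 1" using T_deg by simp
  \<comment> \<open>The quotient by \<open>p\<close> is taken once, before specialising
    \<open>t\<close>, so that its values at \<open>c\<close> and \<open>0\<close> can be
    compared.\<close>
  obtain E where E: "root_power T p \<circ>\<^sub>p monom 1 p - root_power T 1 ^ p = of_nat p * E"
    using root_power_prime_cong[OF T p] by (auto simp: dvd_def)
  define ev where "ev z f = map_poly (\<lambda>g. poly g z) f" for z :: int and f :: "int poly poly"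
  have ev: "root_power S p \<circ>\<^sub>p monom 1 p = S ^ p + of_nat p * ev z E"
    if S: "ev z T = S" "lead_coeff S = 1" for z S
  proof -
    interpret map_poly_hom: map_poly_comm_ring_hom "\<lambda>g. poly g z" ..
    have rp: "ev z (root_power T k) = root_power S k" for k
      unfolding S(1)[symmetric] ev_def by (rule root_power_hom[OF poly_hom.comm_ring_hom_axioms T])
    have "ev z (root_power T p \<circ>\<^sub>p monom 1 p - root_power T 1 ^ p) = ev z (of_nat p * E)"
      by (simp only: E)
    then have "root_power S p \<circ>\<^sub>p monom 1 p - root_power S 1 ^ p = of_nat p * ev z E"
      unfolding rp[symmetric] ev_def by (simp add: hom_distribs poly_hom.map_poly_pcompose)
    then show ?thesis unfolding root_power_1[OF S(2)] by (simp add: algebra_simps)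
  qed
  have "ev c T = P" "ev 0 T = R"
    by (auto intro!: poly_eqI simp: ev_def T_def H coeff_map_poly)
  then have "(root_power P p - root_power R p) \<circ>\<^sub>p monom 1 p
      = (P ^ p - R ^ p) + (ev c E - ev 0 E) * of_nat p"
    by (simp add: pcompose_diff ev[OF _ P] ev[OF _ R] algebra_simps)
  moreover have "[:c:] * of_nat p dvd P ^ p - R ^ p"
    using c by (intro dvd_power_prime_diff PR) (simp add: of_nat_poly)
  moreover have "[:c:] dvd ev c E - ev 0 E"
  proof -
    have "c dvd poly g c - poly g 0" for g by (cases g) simp
    then show ?thesis by (simp add: const_poly_dvd_iff ev_def coeff_map_poly)
  qed
  moreover have "[:c * int p:] = [:c:] * of_nat p" by (simp add: of_nat_poly mult.commute)
  ultimately show "[:c * int p:] dvd (root_power P p - root_power R p) \<circ>\<^sub>p monom 1 p"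
    by (metis dvd_add dvd_refl mult_dvd_mono)
  show "p > 0" using p by (rule prime_gt_0_nat)
qed

lemma root_power_prime_power_cong:
  assumes P: "lead_coeff P = 1" and p: "prime p"
  shows "[:int p ^ Suc k:] dvd root_power P (m * p ^ Suc k) - root_power P (m * p ^ k)"
proof (induction k)
  case 0
  show ?case using root_power_prime_base[OF lead_coeff_root_power[OF P] p]
    by (simp add: root_power_root_power[OF P])
next
  case (Suc k)
  have "[:int p ^ Suc k * int p:] dvd root_power (root_power P (m * p ^ Suc k)) p
      - root_power (root_power P (m * p ^ k)) p"
    by (intro root_power_prime_step Suc.IH p lead_coeff_root_power[OF P])
      (use p in \<open>auto simp: degree_root_power[OF P] prime_gt_0_nat\<close>)
  then show ?case by (simp add: root_power_root_power[OF P] mult_ac)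
qed

section \<open>Moebius sums\<close>

lemma moebius_mu_prime_mult:
  assumes p: "prime p" and f: "\<not> p dvd f"
  shows "moebius_mu (p * f) = - moebius_mu f"
proof -
  have "f \<noteq> 0" using f by (metis dvd_0_right)
  have "p \<noteq> 0" using p by auto
  have "coprime p f" using p f by (simp add: prime_imp_coprime)
  then have "squarefree (p * f) \<longleftrightarrow> squarefree f"
    using squarefree_mult_coprime[of p f] squarefree_multD[of p f] squarefree_prime[OF p] by blast
  moreover have "prime_factors (p * f) = insert p (prime_factors f)"
    using \<open>f \<noteq> 0\<close> \<open>p \<noteq> 0\<close> p by (simp add: prime_factors_product prime_prime_factors)
  moreover have "p \<notin> prime_factors f" using f by (auto dest: in_prime_factors_imp_dvd)
  ultimately show ?thesis by (simp add: moebius_mu_def)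
qed

lemma moebius_mu_eq_0: "prime p \<Longrightarrow> p\<^sup>2 dvd e \<Longrightarrow> moebius_mu e = 0"
  by (auto simp: moebius_mu_def squarefree_def)

text \<open>With \<open>e = n div m\<close>, only divisors \<open>e\<close> not divisible by
  \<open>p^2\<close> contribute. These are \<open>f\<close> and \<open>p * f\<close> with
  \<open>f\<close> dividing \<open>r\<close>, and their Moebius values are opposite.\<close>

lemma moebius_sum_prime_power:
  fixes a :: "nat \<Rightarrow> 'a::comm_ring_1"
  assumes p: "prime p" and r: "\<not> p dvd r" and n: "n = r * p ^ Suc k"
  shows "(\<Sum>m | m dvd n. of_int (moebius_mu (n div m)) * a m)
    = (\<Sum>f | f dvd r. of_int (moebius_mu f) * (a (r div f * p ^ Suc k) - a (r div f * p ^ k)))"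
proof -
  let ?g = "\<lambda>e. of_int (moebius_mu e) * a (n div e)" and ?D = "{f. f dvd r}"
  have "r > 0" using r by (cases r) auto
  have "p > 0" using p by (rule prime_gt_0_nat)
  have "n > 0" using \<open>r > 0\<close> \<open>p > 0\<close> by (simp add: n)
  have "finite ?D" using \<open>r > 0\<close> by simp
  have "(\<Sum>m | m dvd n. of_int (moebius_mu (n div m)) * a m) = (\<Sum>e | e dvd n. ?g e)"
    by (rule sum.reindex_bij_witness[where i = "\<lambda>e. n div e" and j = "\<lambda>e. n div e"])
      (use \<open>n > 0\<close> in \<open>auto elim: dvdE\<close>)
  also have "\<dots> = (\<Sum>e\<in>?D \<union> (*) p ` ?D. ?g e)"
  proof (rule sum.mono_neutral_right)
    show "finite {e. e dvd n}" using \<open>n > 0\<close> by simp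
    show "?D \<union> (*) p ` ?D \<subseteq> {e. e dvd n}" by (auto simp: n intro: mult_dvd_mono)
    have "moebius_mu e = 0" if e: "e dvd n" "\<not> e dvd r" "e \<notin> (*) p ` ?D" for e
    proof -
      \<comment> \<open>Divisors of \<open>n\<close> prime to \<open>p\<close> divide
        \<open>r\<close>; hence any remaining \<open>e\<close> is \<open>p * f\<close> with
        \<open>p\<close> dividing \<open>f\<close>.\<close>
      have coprime_dvd: "f dvd r" if "f dvd n" "\<not> p dvd f" for f
        using that p by (metis n coprime_commute coprime_dvd_mult_left_iff coprime_power_right_iff prime_imp_coprime)
      obtain f where f: "e = p * f" using coprime_dvd e(1,2) by (metis dvdE)
      then have "p dvd f" using coprime_dvd[of f] e by (auto dest: dvd_mult_right)
      then show ?thesis using p f by (intro moebius_mu_eq_0[of p]) (auto simp: power2_eq_square)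
    qed
    then show "\<forall>e\<in>{e. e dvd n} - (?D \<union> (*) p ` ?D). ?g e = 0" by auto
  qed
  also have "\<dots> = (\<Sum>f\<in>?D. ?g f) + (\<Sum>e\<in>(*) p ` ?D. ?g e)"
    using r \<open>finite ?D\<close> by (intro sum.union_disjoint) (auto dest: dvd_mult_left)
  also have "(\<Sum>e\<in>(*) p ` ?D. ?g e) = (\<Sum>f\<in>?D. ?g (p * f))"
    using \<open>p > 0\<close> by (subst sum.reindex) (auto simp: inj_on_def)
  also have "(\<Sum>f\<in>?D. ?g f) + \<dots>
      = (\<Sum>f\<in>?D. of_int (moebius_mu f) * (a (r div f * p ^ Suc k) - a (r div f * p ^ k)))"
    unfolding sum.distrib[symmetric]
  proof (rule sum.cong)
    fix f assume "f \<in> ?D"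
    then obtain s where s: "r = f * s" by (auto elim: dvdE)
    have "f > 0" using \<open>r > 0\<close> s by (cases f) auto
    have "moebius_mu (p * f) = - moebius_mu f"
      using r s by (intro moebius_mu_prime_mult p) auto
    moreover have "n div f = r div f * p ^ Suc k" "n div (p * f) = r div f * p ^ k"
      using \<open>f > 0\<close> \<open>p > 0\<close> by (simp_all add: n s mult.assoc)
    ultimately show "?g f + ?g (p * f)
        = of_int (moebius_mu f) * (a (r div f * p ^ Suc k) - a (r div f * p ^ k))"
      by (simp add: algebra_simps)
  qed simp
  finally show ?thesis .
qed

lemma dvd_moebius_sum:
  fixes a :: "nat \<Rightarrow> int"
  assumes a: "\<And>p k m. prime p \<Longrightarrow> int p ^ Suc k dvd a (m * p ^ Suc k) - a (m * p ^ k)"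
    and n: "n > 0"
  shows "int n dvd (\<Sum>m | m dvd n. moebius_mu (n div m) * a m)" (is "_ dvd ?S")
\<comment> \<open>Divisibility is tested through multiplicities at each prime, which is informative
  only for a nonzero sum.\<close>
proof (cases "?S = 0")
  case False
  have "n dvd nat \<bar>?S\<bar>"
  proof (rule multiplicity_le_imp_dvd)
    show "n \<noteq> 0" using n by simp
    fix p :: nat assume p: "prime p"
    show "multiplicity p n \<le> multiplicity p (nat \<bar>?S\<bar>)"
    proof (cases "multiplicity p n")
      case (Suc k)
      obtain r where r: "n = r * p ^ Suc k" "\<not> p dvd r"
        using multiplicity_decompose'[of n p] n p Suc by (metis mult.commute not_gr0 not_prime_unit)
      have "int p ^ Suc k dvd ?S"
        using moebius_sum_prime_power[OF p r(2,1), of a]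
        by (simp del: power_Suc add: a[OF p] dvd_sum)
      then have "p ^ Suc k dvd nat \<bar>?S\<bar>"
        by (simp only: dvd_nat_abs_iff of_nat_power)
      then show ?thesis unfolding Suc using False p by (intro multiplicity_geI) auto
    qed simp
  qed
  then show ?thesis by (simp only: dvd_nat_abs_iff)
qed simp

theorem theorem5p2:
  fixes P Q :: "int poly" and n :: nat
  assumes "lead_coeff P = 1" and "lead_coeff Q = 1" and "n > 0"
  shows "\<exists>s :: int.
    of_int s = (\<Sum>m | m dvd n. of_int (moebius_mu (n div m)) *
                  monic_resultant (root_power_poly P m) (complex_poly Q)) \<and>
    [s = 0] (mod int n)"
proof -
  \<comment> \<open>The integer value of the resultant; its Moebius sum is the witness
    \<open>s\<close>.\<close>
  define a where "a m = (-1) ^ (degree P * degree Q) * quotient_norm Q (root_power P m)" for m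
  have "int p ^ Suc k dvd a (m * p ^ Suc k) - a (m * p ^ k)" if p: "prime p" for p k m
    unfolding a_def right_diff_distrib[symmetric]
    by (intro dvd_mult quotient_norm_cong assms root_power_prime_power_cong p)
  then have "int n dvd (\<Sum>m | m dvd n. moebius_mu (n div m) * a m)"
    by (rule dvd_moebius_sum[OF _ assms(3)])
  moreover have "of_int (\<Sum>m | m dvd n. moebius_mu (n div m) * a m)
    = (\<Sum>m | m dvd n. of_int (moebius_mu (n div m)) *
                  monic_resultant (root_power_poly P m) (complex_poly Q))"
    by (simp only: monic_resultant_root_power_poly[OF assms(1,2)] a_def of_int_sum of_int_mult)
  ultimately show ?thesis unfolding cong_0_iff by blast
qed

end
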